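(* Let $\varrho>0$, $\varepsilon>0$, $\omega\in(0,1)\setminus\mathbb{Q}$ and $0<\delta'<\delta<\varrho$. Put $\Delta=(1+\omega)\delta$ and suppose that $\mathfrak{Brj}_1(\Delta)=\infty$ or $\mathfrak{Brj}_2(2\Delta)=\infty$. Let $\hat a$ be the function with Fourier coefficients $$\hat a_{p,q}=\begin{cases}\varepsilon e^{-\varrho(|p|+|q|)}\cdot\alpha_n&\text{if }(p,q)=\pm(p_n,q_n)\text{ for some }n\geqslant1,\\0&\text{for all remaining }(p,q)\in\mathbb{Z}^2\setminus\{(0,0)\},\end{cases}$$ where $\alpha_n=\frac{1}{2\bar\alpha q_n}$ and $\bar\alpha=\sum_{n=1}^\infty\frac1{q_n}$. Then $\hat g$, the formal solution of the cohomological equation $(\partial_x+\omega\,\partial_y)\hat g=\hat a$, does not belong to $\mathcal{P}_0(\varrho-\delta')$.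
   Context: For $\varrho>0$ let $\Pi(\varrho)=\{z\in\mathbb{C}:|\operatorname{Im}z|<\varrho\}$. $\mathcal{P}_0(\varrho)$ is the set of continuous functions $b:\overline{\Pi(\varrho)^2}\to\mathbb{C}$ that are holomorphic on $\Pi(\varrho)^2$, $2\pi$-periodic in both variables, satisfy $b(\mathbb{R}^2)\subset\mathbb{R}$, and have zero average over $[0,2\pi)^2$. For irrational $\omega\in(0,1)$ with continued fraction expansion $\omega=[a_1,a_2,\ldots]$ (partial quotients $a_j\geqslant1$), $p_n/q_n$ denotes its $n$-th convergent (reduced fraction, obtained by truncating the expansion at $a_n$). For $\Delta>0$, $\mathfrak{Brj}_1(\Delta)=\sum_{n=1}^\infty e^{-q_n\Delta}q_{n+1}$ and $\mathfrak{Brj}_2(\Delta)=\sum_{n=1}^\infty e^{-q_n\Delta}q_{n+1}\log a_{n+1}$. Fourier expansions are taken with respect to $e_{p,q}(x,y)=\exp(i(px-qy))$, i.e. $b=\sum_{(p,q)\in\mathbb{Z}^2\setminus\{(0,0)\}}b_{p,q}e_{p,q}$ for zero-average $b$. The formal solution of the cohomological equation with data $\hat a$ is the (not necessarily convergent) zero-mean Fourier series $\hat g$ with coefficients $\hat g_{p,q}=\frac{\hat a_{p,q}}{i(p-q\omega)}$, $(p,q)\neq(0,0)$; it belongs to $\mathcal{P}_0(R)$ if it is the Fourier series of a function in $\mathcal{P}_0(R)$. *)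

theory Defs
  imports "HOL-Analysis.Analysis"
begin

subsection \<open>Analytic functions on a complex neighbourhood of the two-torus\<close>

definition strip :: "real \<Rightarrow> complex set" where
  "strip r = {z. \<bar>Im z\<bar> < r}"

text \<open>The library has holomorphy in one complex variable only.  Here a function of two complex
  variables is holomorphic on an open set if it has a complex-linear Frechet derivative at
  every point of that set.\<close>

definition holomorphic2_on :: "(complex \<times> complex \<Rightarrow> complex) \<Rightarrow> (complex \<times> complex) set \<Rightarrow> bool" where
  "holomorphic2_on f S \<longleftrightarrow>
     (\<forall>z\<in>S. \<exists>A B. (f has_derivative (\<lambda>(h, k). A * h + B * k)) (at z))"

definition torus_avg :: "(complex \<times> complex \<Rightarrow> complex) \<Rightarrow> complex" where
  "torus_avg f = complex_of_real (1 / (2 * pi)\<^sup>2) *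
     set_lebesgue_integral lborel ({0..<2*pi} \<times> {0..<2*pi})
       (\<lambda>(x, y). f (complex_of_real x, complex_of_real y))"

text \<open>Functions are total in HOL; all conditions constrain \<open>b\<close> only on the closed domain, and its
  values elsewhere are irrelevant.\<close>

definition P0 :: "real \<Rightarrow> (complex \<times> complex \<Rightarrow> complex) set" where
  "P0 r = {b. continuous_on (closure (strip r \<times> strip r)) b
            \<and> holomorphic2_on b (strip r \<times> strip r)
            \<and> (\<forall>(z, w) \<in> closure (strip r \<times> strip r).
                  b (z + 2 * pi, w) = b (z, w) \<and> b (z, w + 2 * pi) = b (z, w))
            \<and> (\<forall>x y :: real. b (complex_of_real x, complex_of_real y) \<in> \<real>)
            \<and> torus_avg b = 0}"

subsection \<open>Fourier series and the cohomological equation\<close>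

definition fourier_mode :: "int \<Rightarrow> int \<Rightarrow> complex \<times> complex \<Rightarrow> complex" where
  "fourier_mode p q = (\<lambda>(x, y). exp (\<i> * (of_int p * x - of_int q * y)))"

text \<open>The coefficient of \<^term>\<open>fourier_mode p q\<close>.  On real arguments the conjugate of
  \<^term>\<open>fourier_mode p q\<close> is \<^term>\<open>fourier_mode (-p) (-q)\<close>.\<close>

definition fourier_coeff :: "(complex \<times> complex \<Rightarrow> complex) \<Rightarrow> int \<Rightarrow> int \<Rightarrow> complex" where
  "fourier_coeff b p q = torus_avg (\<lambda>z. b z * fourier_mode (-p) (-q) z)"

text \<open>A formal Fourier series is represented by its family of coefficients.  Since \<open>\<partial>\<^sub>x + \<omega> \<partial>\<^sub>y\<close>
  multiplies \<^term>\<open>fourier_mode p q\<close> by \<open>\<i> (p - q \<omega>)\<close>, the following is the formal zero-mean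
  solution \<open>g\<close> of \<open>(\<partial>\<^sub>x + \<omega> \<partial>\<^sub>y) g = a\<close>.\<close>

definition formal_solution ::
    "real \<Rightarrow> (complex \<times> complex \<Rightarrow> complex) \<Rightarrow> int \<Rightarrow> int \<Rightarrow> complex" where
  "formal_solution \<omega> a p q =
     (if (p, q) = (0, 0) then 0
      else fourier_coeff a p q / (\<i> * complex_of_real (of_int p - of_int q * \<omega>)))"

definition series_in_P0 :: "(int \<Rightarrow> int \<Rightarrow> complex) \<Rightarrow> real \<Rightarrow> bool" where
  "series_in_P0 c r \<longleftrightarrow> (\<exists>b\<in>P0 r. \<forall>p q. fourier_coeff b p q = c p q)"

subsection \<open>Continued fractions\<close>

text \<open>\<open>cf_rem \<omega> n\<close> is the \<open>n\<close>-th iterate of the Gauss map, so that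
  \<open>\<omega> = [cf_quot \<omega> 1, cf_quot \<omega> 2, \<dots>]\<close> for irrational \<open>\<omega> \<in> (0,1)\<close>;
  the value of \<^term>\<open>cf_quot \<omega> 0\<close> is never used.\<close>

fun cf_rem :: "real \<Rightarrow> nat \<Rightarrow> real" where
  "cf_rem \<omega> 0 = \<omega>"
| "cf_rem \<omega> (Suc n) = frac (1 / cf_rem \<omega> n)"

definition cf_quot :: "real \<Rightarrow> nat \<Rightarrow> int" where
  "cf_quot \<omega> n = \<lfloor>1 / cf_rem \<omega> (n - 1)\<rfloor>"

fun cf_value :: "int list \<Rightarrow> rat" where
  "cf_value [] = 0"
| "cf_value (a # as) = 1 / (of_int a + cf_value as)"

definition cf_convergent :: "real \<Rightarrow> nat \<Rightarrow> rat" where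
  "cf_convergent \<omega> n = cf_value (map (cf_quot \<omega>) [1..<Suc n])"

text \<open>\<^const>\<open>quotient_of\<close> returns the reduced fraction with positive denominator.\<close>

definition conv_num :: "real \<Rightarrow> nat \<Rightarrow> int" where
  "conv_num \<omega> n = fst (quotient_of (cf_convergent \<omega> n))"

definition conv_den :: "real \<Rightarrow> nat \<Rightarrow> int" where
  "conv_den \<omega> n = snd (quotient_of (cf_convergent \<omega> n))"

text \<open>The sums over \<open>n \<ge> 1\<close> below are written with index \<open>Suc n\<close>.  The terms of the two Brjuno-type
  sums are nonnegative for irrational \<open>\<omega> \<in> (0,1)\<close>, so the sums are taken in \<^typ>\<open>ennreal\<close>.\<close>

definition Brj1 :: "real \<Rightarrow> real \<Rightarrow> ennreal" where
  "Brj1 \<omega> \<Delta> = (\<Sum>n. ennreal (exp (- (of_int (conv_den \<omega> (Suc n)) * \<Delta>))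
                  * of_int (conv_den \<omega> (Suc n + 1))))"

definition Brj2 :: "real \<Rightarrow> real \<Rightarrow> ennreal" where
  "Brj2 \<omega> \<Delta> = (\<Sum>n. ennreal (exp (- (of_int (conv_den \<omega> (Suc n)) * \<Delta>))
                  * of_int (conv_den \<omega> (Suc n + 1)) * ln (of_int (cf_quot \<omega> (Suc n + 1)))))"

definition alpha_bar :: "real \<Rightarrow> real" where
  "alpha_bar \<omega> = (\<Sum>n. 1 / of_int (conv_den \<omega> (Suc n)))"

definition alpha :: "real \<Rightarrow> nat \<Rightarrow> real" where
  "alpha \<omega> n = 1 / (2 * alpha_bar \<omega> * of_int (conv_den \<omega> n))"

end

theory Submission
  imports Defs "HOL-Complex_Analysis.Cauchy_Integral_Theorem"
begin

text \<open>If the formal solution were in \<open>P0 (\<rho> - \<delta>')\<close>, shifting the contours in both variables would bound its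
  coefficients by \<open>M exp (-(\<rho> - \<sigma>) (\<bar>p\<bar> + \<bar>q\<bar>))\<close> for any \<open>\<sigma> > \<delta>'\<close>; we take \<open>\<delta>' < \<sigma> < \<delta>\<close>.  At
  \<open>(p\<^sub>n, q\<^sub>n)\<close> the coefficient has modulus at least a constant times \<open>exp (-\<rho> (p\<^sub>n + q\<^sub>n)) q\<^sub>n\<^sub>+\<^sub>1 / q\<^sub>n\<close>, because
  \<open>\<bar>p\<^sub>n - q\<^sub>n \<omega>\<bar> \<le> 1 / q\<^sub>n\<^sub>+\<^sub>1\<close>.  Since \<open>p\<^sub>n \<le> 1 + \<omega> q\<^sub>n\<close>, this gives \<open>q\<^sub>n\<^sub>+\<^sub>1 \<le> C q\<^sub>n exp ((1 + \<omega>) \<sigma> q\<^sub>n)\<close>, and as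
  \<open>(1 + \<omega>) \<sigma> < \<Delta>\<close> both Brjuno-type sums are then dominated by a multiple of the convergent series
  \<open>\<Sum>n. 1 / q\<^sub>n\<close>.\<close>

subsection \<open>Decay of Fourier coefficients\<close>

lemma strip_alt: "strip r = {z. Im z < r} \<inter> {z. Im z > -r}"
  by (auto simp: strip_def)

lemma open_strip: "open (strip r)"
  unfolding strip_alt by (intro open_Int open_halfspace_Im_lt open_halfspace_Im_gt)

lemma convex_strip: "convex (strip r)"
  unfolding strip_alt by (intro convex_Int convex_halfspace_Im_lt convex_halfspace_Im_gt)

text \<open>The half-open square differs from the closed one by a null set. On the closed square
  continuity gives integrability, and the gauge integral makes Fubini for continuous integrands
  available.\<close>

lemma torus_avg_eq_integral:
  assumes cont: "continuous_on (cbox (0, 0) (2*pi, 2*pi)) (\<lambda>(x, y). f (complex_of_real x, complex_of_real y))"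
  shows "torus_avg f = complex_of_real (1 / (2 * pi)\<^sup>2) *
    integral (cbox (0, 0) (2*pi, 2*pi)) (\<lambda>(x, y). f (complex_of_real x, complex_of_real y))"
proof -
  let ?F = "\<lambda>(x, y). f (complex_of_real x, complex_of_real y)"
  let ?C = "cbox (0, 0) (2*pi, 2*pi) :: (real \<times> real) set"
  let ?S = "{0..<2*pi} \<times> {0..<2*pi}"
  have int: "set_integrable lborel ?C ?F"
    unfolding set_integrable_def by (rule borel_integrable_compact[OF compact_cbox cont])
  have sub: "?S \<subseteq> ?C"
    by (auto simp: cbox_Pair_eq)
  have "set_integrable lborel ?S ?F"
    by (rule set_integrable_subset[OF int _ sub]) (simp add: borel_Times)
  then have "set_lebesgue_integral lborel ?S ?F = integral ?S ?F"
    by (rule set_borel_integral_eq_integral)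
  also have "\<dots> = integral ?C ?F"
  proof (rule integral_subset_negligible[OF sub])
    have "box (0, 0) (2*pi, 2*pi) \<subseteq> ?S"
      by (auto simp: box_def Basis_prod_def ball_Un)
    then show "negligible (?C - ?S)"
      by (intro negligible_subset[OF negligible_frontier_interval[of "(0, 0)" "(2*pi, 2*pi)"]]) blast
  qed
  finally show ?thesis by (simp add: torus_avg_def)
qed

lemma norm_torus_avg_le:
  assumes "continuous_on (cbox (0, 0) (2*pi, 2*pi)) (\<lambda>(x, y). f (complex_of_real x, complex_of_real y))"
    and bound: "\<And>x y. x \<in> {0..2*pi} \<Longrightarrow> y \<in> {0..2*pi} \<Longrightarrow> norm (f (complex_of_real x, complex_of_real y)) \<le> B"
  shows "norm (torus_avg f) \<le> B"
proof -
  let ?F = "\<lambda>(x, y). f (complex_of_real x, complex_of_real y)"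
  let ?C = "cbox (0, 0) (2*pi, 2*pi) :: (real \<times> real) set"
  have "0 \<le> B"
    using bound[of 0 0] norm_ge_zero order_trans pi_ge_zero
    by (metis atLeastAtMost_iff mult_nonneg_nonneg order_refl zero_le_numeral)
  moreover have "(?F has_integral integral ?C ?F) ?C"
    using assms(1) by (intro integrable_integral integrable_continuous)
  ultimately have "norm (integral ?C ?F) \<le> B * measure lborel ?C"
    by (rule has_integral_bound) (auto simp: cbox_Pair_eq bound)
  also have "measure lborel ?C = (2*pi)\<^sup>2"
    by (simp add: content_Pair power2_eq_square)
  finally have *: "norm (integral ?C ?F) \<le> B * (2*pi)\<^sup>2" .
  have "norm (torus_avg f) = 1 / (2 * pi)\<^sup>2 * norm (integral ?C ?F)"
    by (simp add: torus_avg_eq_integral[OF assms(1)] norm_mult norm_divide norm_power)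
  also have "\<dots> \<le> B"
    using * by (simp add: field_simps)
  finally show ?thesis .
qed

text \<open>The increment of a primitive over one period has derivative zero, hence is constant on
  the strip.\<close>

lemma period_integral_shift:
  assumes holo: "g holomorphic_on strip r"
    and per: "\<And>z. z \<in> strip r \<Longrightarrow> g (z + 2 * pi) = g z"
    and u: "\<bar>u\<bar> < r"
  shows "integral {0..2*pi} (\<lambda>x. g (complex_of_real x + \<i> * u)) = integral {0..2*pi} (\<lambda>x. g (complex_of_real x))"
proof -
  obtain G where "\<And>z. z \<in> strip r \<Longrightarrow> (G has_field_derivative g z) (at z within strip r)"
    using holomorphic_convex_primitive'[OF convex_strip open_strip holo] by blast
  then have G: "(G has_field_derivative g z) (at z)" if "z \<in> strip r" for z
    using that by (simp add: at_within_open[OF _ open_strip])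
  have "((\<lambda>z. G (z + 2 * pi) - G z) has_field_derivative 0) (at z within strip r)"
    if z: "z \<in> strip r" for z
  proof -
    have z': "z + 2 * pi \<in> strip r"
      using z by (simp add: strip_def)
    have "((\<lambda>z. G (z + 2 * pi)) has_field_derivative g (z + 2 * pi)) (at z)"
      using G[OF z'] by (simp only: DERIV_shift)
    then have "((\<lambda>z. G (z + 2 * pi) - G z) has_field_derivative g (z + 2 * pi) - g z) (at z)"
      by (intro derivative_intros G z)
    then show ?thesis
      using per[OF z] by (simp add: has_field_derivative_at_within)
  qed
  from has_field_derivative_zero_constant[OF convex_strip this]
  obtain c where c: "\<And>z. z \<in> strip r \<Longrightarrow> G (z + 2 * pi) - G z = c"
    by auto
  \<comment> \<open>The fundamental theorem of calculus on the segment at height \<open>t\<close>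
    yields the same increment \<open>c\<close> for every \<open>t\<close>; heights \<open>u\<close>
    and \<open>0\<close> are compared at the end.\<close>
  have "((\<lambda>x. g (complex_of_real x + \<i> * t)) has_integral c) {0..2*pi}" if t: "\<bar>t\<bar> < r" for t :: real
  proof -
    have "((\<lambda>x. G (complex_of_real x + \<i> * t)) has_vector_derivative g (complex_of_real x + \<i> * t))
        (at x within {0..2*pi})" for x
    proof -
      have "complex_of_real x + \<i> * t \<in> strip r"
        using t by (simp add: strip_def)
      then have dG: "(G has_field_derivative g (complex_of_real x + \<i> * t))
          (at (complex_of_real x + \<i> * t) within (\<lambda>x. complex_of_real x + \<i> * t) ` {0..2*pi})"
        by (rule has_field_derivative_at_within[OF G])
      have "((\<lambda>x. complex_of_real x + \<i> * t) has_vector_derivative 1) (at x within {0..2*pi})"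
        by (rule derivative_eq_intros refl | simp)+
      from field_vector_diff_chain_within[OF this dG] show ?thesis
        unfolding o_def mult_1_left .
    qed
    then have "((\<lambda>x. g (complex_of_real x + \<i> * t)) has_integral
        (G (complex_of_real (2*pi) + \<i> * t) - G (complex_of_real 0 + \<i> * t))) {0..2*pi}"
      by (intro fundamental_theorem_of_calculus) auto
    moreover have "G (complex_of_real (2*pi) + \<i> * t) - G (complex_of_real 0 + \<i> * t) = c"
      using c[of "\<i> * t"] t by (simp add: strip_def add.commute)
    ultimately show ?thesis by simp
  qed
  note period = this
  have "\<bar>0\<bar> < r"
    using u by linarith
  from integral_unique[OF period[OF u]] integral_unique[OF period[OF this]] show ?thesis
    by simp
qed

text \<open>Fubini reduces this to one variable: shift the inner integral in \<open>y\<close>,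
  exchange the order, shift in \<open>x\<close>, exchange back. Separate holomorphy serves the
  shifts, joint continuity the exchanges.\<close>

lemma torus_avg_shift:
  assumes cont: "continuous_on (strip r \<times> strip r) f"
    and holo1: "\<And>w. w \<in> strip r \<Longrightarrow> (\<lambda>z. f (z, w)) holomorphic_on strip r"
    and holo2: "\<And>z. z \<in> strip r \<Longrightarrow> (\<lambda>w. f (z, w)) holomorphic_on strip r"
    and per1: "\<And>z w. z \<in> strip r \<Longrightarrow> w \<in> strip r \<Longrightarrow> f (z + 2 * pi, w) = f (z, w)"
    and per2: "\<And>z w. z \<in> strip r \<Longrightarrow> w \<in> strip r \<Longrightarrow> f (z, w + 2 * pi) = f (z, w)"
    and u: "\<bar>u\<bar> < r" and v: "\<bar>v\<bar> < r"
  shows "torus_avg f = torus_avg (\<lambda>(z, w). f (z + \<i> * u, w + \<i> * v))"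
proof -
  let ?I = "{0..2*pi}"
  have strip: "complex_of_real x + \<i> * t \<in> strip r" if "\<bar>t\<bar> < r" for x t :: real
    using that by (simp add: strip_def)
  have strip0: "complex_of_real x \<in> strip r" for x
    using strip[of 0 x] u by simp
  have cont': "continuous_on A (\<lambda>(x, y). f (complex_of_real x + \<i> * s, complex_of_real y + \<i> * t))"
    if "\<bar>s\<bar> < r" "\<bar>t\<bar> < r" for A and s t :: real
    unfolding case_prod_unfold
    by (rule continuous_on_compose2[OF cont])
      (auto intro!: continuous_intros simp: strip that)
  have avg: "torus_avg (\<lambda>(z, w). f (z + \<i> * s, w + \<i> * t)) = complex_of_real (1 / (2 * pi)\<^sup>2) *
      integral ?I (\<lambda>x. integral ?I (\<lambda>y. f (complex_of_real x + \<i> * s, complex_of_real y + \<i> * t)))"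
    if "\<bar>s\<bar> < r" "\<bar>t\<bar> < r" for s t :: real
    using torus_avg_eq_integral[of "\<lambda>(z, w). f (z + \<i> * s, w + \<i> * t)"] cont'[OF that]
      integral_prod_continuous[of 0 0 "2*pi" "2*pi" "\<lambda>(x, y). f (complex_of_real x + \<i> * s, complex_of_real y + \<i> * t)"]
    by simp
  have swap: "integral ?I (\<lambda>x. integral ?I (\<lambda>y. f (complex_of_real x + \<i> * s, complex_of_real y + \<i> * t)))
      = integral ?I (\<lambda>y. integral ?I (\<lambda>x. f (complex_of_real x + \<i> * s, complex_of_real y + \<i> * t)))"
    if "\<bar>s\<bar> < r" "\<bar>t\<bar> < r" for s t :: real
    using integral_swap_continuous[of 0 0 "2*pi" "2*pi"
        "\<lambda>x y. f (complex_of_real x + \<i> * s, complex_of_real y + \<i> * t)"] cont'[OF that]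
    by simp
  have "integral ?I (\<lambda>x. integral ?I (\<lambda>y. f (complex_of_real x, complex_of_real y)))
      = integral ?I (\<lambda>x. integral ?I (\<lambda>y. f (complex_of_real x, complex_of_real y + \<i> * v)))"
    using period_integral_shift[OF holo2 per2 v] strip0 by simp
  also have "\<dots> = integral ?I (\<lambda>y. integral ?I (\<lambda>x. f (complex_of_real x, complex_of_real y + \<i> * v)))"
    using swap[of 0 v] u v by simp
  also have "\<dots> = integral ?I (\<lambda>y. integral ?I (\<lambda>x. f (complex_of_real x + \<i> * u, complex_of_real y + \<i> * v)))"
    using period_integral_shift[OF holo1 per1 u] strip[OF v] by simp
  also have "\<dots> = integral ?I (\<lambda>x. integral ?I (\<lambda>y. f (complex_of_real x + \<i> * u, complex_of_real y + \<i> * v)))"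
    using swap[OF u v] by simp
  finally show ?thesis
    using avg[OF u v] avg[of 0 0] u by (simp add: case_prod_unfold)
qed

section \<open>Holomorphy in two variables and the size of Fourier coefficients\<close>

lemma holomorphic2_on_imp_continuous_on:
  assumes "holomorphic2_on f S"
  shows "continuous_on S f"
  using assms unfolding holomorphic2_on_def
  by (meson continuous_at_imp_continuous_on has_derivative_continuous)

lemma holomorphic2_on_imp_holomorphic_on:
  assumes f: "holomorphic2_on f (S \<times> T)"
  shows "w \<in> T \<Longrightarrow> (\<lambda>z. f (z, w)) holomorphic_on S"
    and "z \<in> S \<Longrightarrow> (\<lambda>w. f (z, w)) holomorphic_on T"
proof -
  assume w: "w \<in> T"
  show "(\<lambda>z. f (z, w)) holomorphic_on S"
    unfolding holomorphic_on_def
  proof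
    fix z assume "z \<in> S"
    then obtain A B where *: "(f has_derivative (\<lambda>(h, k). A * h + B * k)) (at (z, w))"
      using f w unfolding holomorphic2_on_def by blast
    have "((\<lambda>z. f (z, w)) has_derivative (\<lambda>h. (\<lambda>(h, k). A * h + B * k) (h, 0))) (at z within S)"
      by (rule has_derivative_compose[of "\<lambda>z. (z, w)"]) (auto intro!: derivative_intros *)
    then show "(\<lambda>z. f (z, w)) field_differentiable at z within S"
      unfolding field_differentiable_def has_field_derivative_def by auto
  qed
next
  assume z: "z \<in> S"
  show "(\<lambda>w. f (z, w)) holomorphic_on T"
    unfolding holomorphic_on_def
  proof
    fix w assume "w \<in> T"
    then obtain A B where *: "(f has_derivative (\<lambda>(h, k). A * h + B * k)) (at (z, w))"
      using f z unfolding holomorphic2_on_def by blast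
    have "((\<lambda>w. f (z, w)) has_derivative (\<lambda>k. (\<lambda>(h, k). A * h + B * k) (0, k))) (at w within T)"
      by (rule has_derivative_compose[of "\<lambda>w. (z, w)"]) (auto intro!: derivative_intros *)
    then show "(\<lambda>w. f (z, w)) field_differentiable at w within T"
      unfolding field_differentiable_def has_field_derivative_def by auto
  qed
qed

lemma exp_ii_int_period: "exp (\<i> * (of_int n * complex_of_real (2 * pi))) = 1"
  using exp_integer_2pi[of "of_int n"] by (simp add: mult_ac)

lemma fourier_mode_periodic:
  fixes z w :: complex
  shows
  "fourier_mode p q (z + 2 * pi, w) = fourier_mode p q (z, w)"
  "fourier_mode p q (z, w + 2 * pi) = fourier_mode p q (z, w)"
proof -
  have "fourier_mode p q (z + 2 * pi, w)
      = exp (\<i> * (of_int p * z - of_int q * w)) * exp (\<i> * (of_int p * complex_of_real (2 * pi)))"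
    unfolding fourier_mode_def split_conv exp_add[symmetric]
    by (rule arg_cong[of _ _ exp]) (simp add: algebra_simps)
  also have "\<dots> = fourier_mode p q (z, w)"
    unfolding exp_ii_int_period by (simp add: fourier_mode_def)
  finally show "fourier_mode p q (z + 2 * pi, w) = fourier_mode p q (z, w)" .
  have "fourier_mode p q (z, w + 2 * pi)
      = exp (\<i> * (of_int p * z - of_int q * w)) * exp (\<i> * (of_int (- q) * complex_of_real (2 * pi)))"
    unfolding fourier_mode_def split_conv exp_add[symmetric]
    by (rule arg_cong[of _ _ exp]) (simp add: algebra_simps)
  also have "\<dots> = fourier_mode p q (z, w)"
    unfolding exp_ii_int_period by (simp add: fourier_mode_def)
  finally show "fourier_mode p q (z, w + 2 * pi) = fourier_mode p q (z, w)" .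
qed

text \<open>The average is moved to contours at height up to \<open>s\<close>, where
  \<open>b\<close> is bounded by compactness because \<open>s < R\<close>; the decay is the modulus
  of the conjugate mode there.\<close>

lemma fourier_coeff_exp_decay:
  assumes b: "b \<in> P0 R" and s: "0 < s" "s < R"
  obtains C where "\<And>p q. norm (fourier_coeff b p q) \<le> C * exp (- s * (\<bar>of_int p\<bar> + \<bar>of_int q\<bar>))"
proof -
  have holo: "holomorphic2_on b (strip R \<times> strip R)"
    using b by (simp add: P0_def)
  have per: "b (z + 2 * pi, w) = b (z, w)" "b (z, w + 2 * pi) = b (z, w)"
      if "z \<in> strip R" "w \<in> strip R" for z w
    using b that closure_subset[of "strip R \<times> strip R"] by (force simp: P0_def)+
  \<comment> \<open>This compact rectangle contains one period of every horizontal contour of height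
    at most \<open>s\<close>.\<close>
  let ?K = "cbox (Complex 0 (-s)) (Complex (2*pi) s)"
  have K: "?K \<subseteq> strip R"
    using s by (auto simp: strip_def in_cbox_complex_iff)
  have "compact (b ` (?K \<times> ?K))"
    using K by (intro compact_continuous_image compact_Times compact_cbox
        continuous_on_subset[OF holomorphic2_on_imp_continuous_on[OF holo]]) auto
  then obtain C where C: "\<And>z w. z \<in> ?K \<Longrightarrow> w \<in> ?K \<Longrightarrow> norm (b (z, w)) \<le> C"
    by (force dest!: compact_imp_bounded simp: bounded_iff)
  show thesis
  proof
    fix p q :: int
    \<comment> \<open>At heights \<open>u\<close> and \<open>v\<close> the conjugate mode has
      modulus \<open>exp (p * u - q * v)\<close>; the signs make this exponent as small as heights
      up to \<open>s\<close> allow.\<close>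
    define u v where "u = - s * sgn (real_of_int p)" and "v = s * sgn (real_of_int q)"
    define f where "f = (\<lambda>z. b z * fourier_mode (- p) (- q) z)"
    have us: "\<bar>u\<bar> \<le> s" and vs: "\<bar>v\<bar> \<le> s"
      using s by (auto simp: u_def v_def abs_mult sgn_if)
    have f: "f (z, w) = b (z, w) * exp (\<i> * (of_int (-p) * z - of_int (-q) * w))" for z w
      by (simp add: f_def fourier_mode_def)
    have contf: "continuous_on (strip R \<times> strip R) f"
      unfolding f_def fourier_mode_def case_prod_unfold
      by (intro continuous_intros holomorphic2_on_imp_continuous_on[OF holo])
    have "torus_avg f = torus_avg (\<lambda>(z, w). f (z + \<i> * u, w + \<i> * v))"
    proof (rule torus_avg_shift[where r = R])
      show "(\<lambda>z. f (z, w)) holomorphic_on strip R" if "w \<in> strip R" for w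
        unfolding f by (intro holomorphic_intros holomorphic2_on_imp_holomorphic_on(1)[OF holo that])
      show "(\<lambda>w. f (z, w)) holomorphic_on strip R" if "z \<in> strip R" for z
        unfolding f by (intro holomorphic_intros holomorphic2_on_imp_holomorphic_on(2)[OF holo that])
    qed (use contf us vs s in \<open>auto simp: f_def per fourier_mode_periodic simp del: of_real_mult\<close>)
    moreover have "norm (torus_avg (\<lambda>(z, w). f (z + \<i> * u, w + \<i> * v)))
        \<le> C * exp (- s * (\<bar>of_int p\<bar> + \<bar>of_int q\<bar>))"
    proof (rule norm_torus_avg_le)
      show "continuous_on (cbox (0, 0) (2*pi, 2*pi))
          (\<lambda>(x, y). (\<lambda>(z, w). f (z + \<i> * u, w + \<i> * v)) (complex_of_real x, complex_of_real y))"
        unfolding case_prod_unfold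
        by (rule continuous_on_compose2[OF contf]) (use us vs s in \<open>auto intro!: continuous_intros simp: strip_def\<close>)
      fix x y :: real
      assume xy: "x \<in> {0..2*pi}" "y \<in> {0..2*pi}"
      have "norm (b (complex_of_real x + \<i> * u, complex_of_real y + \<i> * v)) \<le> C"
        using us vs xy by (intro C) (auto simp: in_cbox_complex_iff)
      moreover have "real_of_int p * u - real_of_int q * v = - s * (\<bar>of_int p\<bar> + \<bar>of_int q\<bar>)"
        by (auto simp: u_def v_def sgn_if abs_if algebra_simps)
      moreover have "norm (f (complex_of_real x + \<i> * u, complex_of_real y + \<i> * v))
          = norm (b (complex_of_real x + \<i> * u, complex_of_real y + \<i> * v)) * exp (real_of_int p * u - real_of_int q * v)"
        by (simp add: f norm_mult)
      ultimately show "norm ((\<lambda>(z, w). f (z + \<i> * u, w + \<i> * v)) (complex_of_real x, complex_of_real y))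
          \<le> C * exp (- s * (\<bar>of_int p\<bar> + \<bar>of_int q\<bar>))"
        by (simp only: split_conv mult_right_mono exp_ge_zero)
    qed
    ultimately show "norm (fourier_coeff b p q) \<le> C * exp (- s * (\<bar>of_int p\<bar> + \<bar>of_int q\<bar>))"
      by (simp add: fourier_coeff_def f_def)
  qed
qed

subsection \<open>Continued fractions\<close>

text \<open>A continued fraction ending in an arbitrary remainder \<open>t\<close>. The field is
  generic so that one formula covers both the rational convergents (\<open>t = 0\<close>) and the
  real number itself (\<open>t\<close> a Gauss iterate).\<close>

fun cf_tail :: "int list \<Rightarrow> 'a::linordered_field \<Rightarrow> 'a" where
  "cf_tail [] t = t"
| "cf_tail (a # as) t = 1 / (of_int a + cf_tail as t)"

text \<open>The recursion peels quotients off the front, while convergents grow at the end; this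
  absorbs the last quotient into the remainder.\<close>

lemma cf_tail_append: "cf_tail (as @ [a]) t = cf_tail as (1 / (of_int a + t))"
  by (induction as) auto

lemma cf_value_eq_cf_tail: "cf_value as = cf_tail as 0"
  by (induction as) auto

text \<open>The seeds \<open>(u, v)\<close> are the terms of index \<open>-1\<close> and \<open>0\<close> in the usual numbering: \<open>(1, 0)\<close> gives
  \<open>p\<^sub>n = cf_seq a 1 0 (n + 1)\<close> and \<open>(0, 1)\<close> gives \<open>q\<^sub>n = cf_seq a 0 1 (n + 1)\<close>.\<close>

fun cf_seq :: "(nat \<Rightarrow> int) \<Rightarrow> int \<Rightarrow> int \<Rightarrow> nat \<Rightarrow> int" where
  "cf_seq a u v 0 = u"
| "cf_seq a u v (Suc 0) = v"
| "cf_seq a u v (Suc (Suc n)) = a (Suc n) * cf_seq a u v (Suc n) + cf_seq a u v n"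

text \<open>A step of the recurrence adds a multiple of one column to the other and swaps them, so
  the determinant only changes sign. Both coprimality and the distance to the convergents come from
  it.\<close>

lemma cf_seq_det:
  "cf_seq a 1 0 (Suc n) * cf_seq a 0 1 n - cf_seq a 1 0 n * cf_seq a 0 1 (Suc n) = (- 1) ^ Suc n"
  by (induction n) (auto simp: algebra_simps)

lemma coprime_cf_seq: "coprime (cf_seq a 1 0 (Suc n)) (cf_seq a 0 1 (Suc n))"
proof (rule coprimeI)
  fix c assume "c dvd cf_seq a 1 0 (Suc n)" "c dvd cf_seq a 0 1 (Suc n)"
  then have "c dvd cf_seq a 1 0 (Suc n) * cf_seq a 0 1 n - cf_seq a 1 0 n * cf_seq a 0 1 (Suc n)"
    by (intro dvd_diff dvd_mult dvd_mult2)
  then show "is_unit c"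
    unfolding cf_seq_det by (metis dvd_trans is_unit_power_iff dvd_refl minus_dvd_iff one_dvd)
qed

context
  fixes a :: "nat \<Rightarrow> int"
  assumes a_pos: "\<And>n. n \<ge> 1 \<Longrightarrow> a n \<ge> 1"
begin

lemma cf_seq_nonneg: "cf_seq a 1 0 n \<ge> 0"
proof (induction n rule: induct_nat_012)
  case (ge2 n)
  then show ?case using a_pos[of "Suc n"] by simp
qed auto

text \<open>Two consecutive terms are carried through the induction because the recurrence looks
  back two places; the earlier one starts at \<open>0\<close>, hence the weaker bound.\<close>

lemma cf_seq_den_pos: "cf_seq a 0 1 n \<ge> 0 \<and> cf_seq a 0 1 (Suc n) \<ge> 1"
proof (induction n)
  case (Suc n)
  then have "1 * 1 \<le> a (Suc n) * cf_seq a 0 1 (Suc n)"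
    using a_pos[of "Suc n"] by (intro mult_mono) auto
  then show ?case using Suc by simp
qed auto

lemma cf_seq_den_growth: "cf_seq a 0 1 (Suc (Suc n)) \<ge> cf_seq a 0 1 (Suc n) + cf_seq a 0 1 n"
proof -
  have "1 * cf_seq a 0 1 (Suc n) \<le> a (Suc n) * cf_seq a 0 1 (Suc n)"
    using a_pos[of "Suc n"] cf_seq_den_pos[of n] by (intro mult_right_mono) auto
  then show ?thesis by simp
qed

text \<open>The rate 3/2 works because its square 9/4 is at most 3/2 + 1; the factor 2/3 allows for
  the first two denominators both being 1.\<close>

lemma cf_seq_den_exp_growth: "(2 / 3) * (3 / 2) ^ n \<le> real_of_int (cf_seq a 0 1 (Suc n))"
proof (induction n rule: induct_nat_012)
  case 1
  then show ?case using cf_seq_den_pos[of 1] by simp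
next
  case (ge2 n)
  have "real_of_int (cf_seq a 0 1 (Suc (Suc n)) + cf_seq a 0 1 (Suc n)) \<le> real_of_int (cf_seq a 0 1 (Suc (Suc (Suc n))))"
    using cf_seq_den_growth[of "Suc n"] by (simp only: of_int_le_iff)
  moreover have "(3 / 2) ^ Suc (Suc n) \<le> (3 / 2) ^ Suc n + (3 / 2 :: real) ^ n"
    by simp
  moreover have "(3 / 2 :: real) ^ n \<ge> 0"
    by simp
  ultimately show ?case
    using ge2 unfolding power_Suc of_int_add by linarith
qed auto

text \<open>Each quotient acts as a Moebius map, and the recurrence multiplies the matrices. The
  remainder varies in the induction, since the last quotient is absorbed into it;
  \<open>t \<ge> 0\<close> keeps the denominators positive.\<close>

lemma cf_tail_eq:
  fixes t :: "'a::linordered_field"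
  assumes "t \<ge> 0"
  shows "cf_tail (map a [1..<Suc n]) t
    = (of_int (cf_seq a 1 0 (Suc n)) + t * of_int (cf_seq a 1 0 n))
      / (of_int (cf_seq a 0 1 (Suc n)) + t * of_int (cf_seq a 0 1 n))"
  using assms
proof (induction n arbitrary: t)
  case (Suc n)
  let ?A = "of_int (a (Suc n)) :: 'a"
  have A: "?A \<ge> 1"
    using a_pos[of "Suc n"] by simp
  then have pos: "?A + t > 0"
    using Suc.prems by linarith
  have split: "map a [1..<Suc (Suc n)] = map a [1..<Suc n] @ [a (Suc n)]"
    by simp
  have "cf_tail (map a [1..<Suc (Suc n)]) t = cf_tail (map a [1..<Suc n]) (1 / (?A + t))"
    unfolding split cf_tail_append ..
  also have "\<dots> = (of_int (cf_seq a 1 0 (Suc n)) + 1 / (?A + t) * of_int (cf_seq a 1 0 n))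
      / (of_int (cf_seq a 0 1 (Suc n)) + 1 / (?A + t) * of_int (cf_seq a 0 1 n))"
    using pos by (intro Suc.IH) auto
  \<comment> \<open>Expanding by \<open>?A + t\<close> clears the nested fraction, so that the
    recurrence can be recognised.\<close>
  also have "\<dots> = ((?A + t) * (of_int (cf_seq a 1 0 (Suc n)) + 1 / (?A + t) * of_int (cf_seq a 1 0 n)))
      / ((?A + t) * (of_int (cf_seq a 0 1 (Suc n)) + 1 / (?A + t) * of_int (cf_seq a 0 1 n)))"
    using pos by (intro mult_divide_mult_cancel_left[symmetric]) simp
  also have "\<dots> = (of_int (cf_seq a 1 0 (Suc (Suc n))) + t * of_int (cf_seq a 1 0 (Suc n)))
      / (of_int (cf_seq a 0 1 (Suc (Suc n))) + t * of_int (cf_seq a 0 1 (Suc n)))"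
    using pos by (simp add: distrib_left) (simp add: algebra_simps)
  finally show ?case .
qed auto

text \<open>The Moebius form at \<open>t = 0\<close> is already reduced, by coprimality, so
  normalisation leaves it alone. This ties the reduced fractions to the recurrence.\<close>

lemma quotient_of_cf_value:
  "quotient_of (cf_value (map a [1..<Suc n])) = (cf_seq a 1 0 (Suc n), cf_seq a 0 1 (Suc n))"
proof -
  have "cf_value (map a [1..<Suc n]) = Fract (cf_seq a 1 0 (Suc n)) (cf_seq a 0 1 (Suc n))"
    unfolding cf_value_eq_cf_tail by (subst cf_tail_eq) (simp_all add: Fract_of_int_quotient)
  moreover have "Rat.normalize (cf_seq a 1 0 (Suc n), cf_seq a 0 1 (Suc n))
      = (cf_seq a 1 0 (Suc n), cf_seq a 0 1 (Suc n))"
    using coprime_cf_seq[of a n] cf_seq_den_pos[of n] by (intro normalize_stable) auto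
  ultimately show ?thesis by (simp add: quotient_of_Fract)
qed

end

section \<open>Gauss iterates and convergents of an irrational number\<close>

context
  fixes \<omega> :: real
  assumes \<omega>: "0 < \<omega>" "\<omega> < 1" "\<omega> \<notin> \<rat>"
begin

text \<open>Irrationality is carried along because it is what keeps the next fractional part from
  vanishing.\<close>

lemma cf_rem_bounds: "0 < cf_rem \<omega> n \<and> cf_rem \<omega> n < 1 \<and> cf_rem \<omega> n \<notin> \<rat>"
proof (induction n)
  case (Suc n)
  have "1 / cf_rem \<omega> n \<notin> \<rat>"
    using Suc Rats_inverse[of "1 / cf_rem \<omega> n"] by (auto simp: field_simps)
  then have "frac (1 / cf_rem \<omega> n) \<notin> \<rat>"
    using Rats_add[of "frac (1 / cf_rem \<omega> n)" "of_int \<lfloor>1 / cf_rem \<omega> n\<rfloor>"] by (auto simp: frac_def)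
  moreover from this have "frac (1 / cf_rem \<omega> n) \<noteq> 0"
    by (metis Rats_0)
  ultimately show ?case
    using frac_ge_0[of "1 / cf_rem \<omega> n"] frac_lt_1[of "1 / cf_rem \<omega> n"] by simp
qed (use \<omega> in auto)

lemma cf_quot_pos: "n \<ge> 1 \<Longrightarrow> cf_quot \<omega> n \<ge> 1"
  using cf_rem_bounds[of "n - 1"] by (simp add: cf_quot_def)

lemma cf_rem_unfold: "cf_rem \<omega> n = 1 / (of_int (cf_quot \<omega> (Suc n)) + cf_rem \<omega> (Suc n))"
  by (simp add: cf_quot_def frac_def)

text \<open>Passing to the next depth trades a remainder for one more quotient and the next
  remainder, which leaves the value unchanged.\<close>

lemma cf_tail_cf_rem: "cf_tail (map (cf_quot \<omega>) [1..<Suc n]) (cf_rem \<omega> n) = \<omega>"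
proof (induction n)
  case (Suc n)
  have split: "map (cf_quot \<omega>) [1..<Suc (Suc n)] = map (cf_quot \<omega>) [1..<Suc n] @ [cf_quot \<omega> (Suc n)]"
    by simp
  show ?case
    unfolding split cf_tail_append cf_rem_unfold[of n, symmetric] by (rule Suc)
qed auto

lemma conv_eq:
  "conv_num \<omega> n = cf_seq (cf_quot \<omega>) 1 0 (Suc n)"
  "conv_den \<omega> n = cf_seq (cf_quot \<omega>) 0 1 (Suc n)"
  by (simp_all only: conv_num_def conv_den_def cf_convergent_def quotient_of_cf_value[of "cf_quot \<omega>", OF cf_quot_pos] fst_conv snd_conv)

lemma conv_num_nonneg: "conv_num \<omega> n \<ge> 0"
  unfolding conv_eq using cf_seq_nonneg[of "cf_quot \<omega>"] cf_quot_pos by blast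

lemma conv_den_ge_1: "conv_den \<omega> n \<ge> 1"
  unfolding conv_eq using cf_seq_den_pos[of "cf_quot \<omega>"] cf_quot_pos by blast

text \<open>Used to bound the logarithm in the second Brjuno-type sum by the denominator next to
  it.\<close>

lemma cf_quot_le_conv_den: "cf_quot \<omega> (Suc n) \<le> conv_den \<omega> (Suc n)"
proof -
  have "cf_quot \<omega> (Suc n) * 1 \<le> cf_quot \<omega> (Suc n) * conv_den \<omega> n"
    using cf_quot_pos[of "Suc n"] conv_den_ge_1[of n] by (intro mult_left_mono) auto
  moreover have "cf_seq (cf_quot \<omega>) 0 1 n \<ge> 0"
    using cf_seq_den_pos[of "cf_quot \<omega>" n] cf_quot_pos by blast
  ultimately show ?thesis by (simp add: conv_eq)
qed

lemma summable_inverse_conv_den: "summable (\<lambda>n. 1 / real_of_int (conv_den \<omega> (Suc n)))"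
proof (rule summable_comparison_test')
  show "summable (\<lambda>n. (2 / 3 :: real) ^ n)"
    by (simp add: summable_geometric)
  fix n :: nat
  \<comment> \<open>The shift to index \<open>Suc n\<close> cancels the factor 2/3 of the growth
    bound.\<close>
  have "(3 / 2) ^ n \<le> real_of_int (conv_den \<omega> (Suc n))"
    using cf_seq_den_exp_growth[of "cf_quot \<omega>" "Suc n"] cf_quot_pos by (simp add: conv_eq del: cf_seq.simps)
  then have "1 / real_of_int (conv_den \<omega> (Suc n)) \<le> 1 / (3 / 2) ^ n"
    by (intro divide_left_mono) (use conv_den_ge_1[of "Suc n"] in auto)
  then show "norm (1 / real_of_int (conv_den \<omega> (Suc n))) \<le> (2 / 3) ^ n"
    using conv_den_ge_1[of "Suc n"] by (simp add: power_divide)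
qed

lemma alpha_bar_pos: "alpha_bar \<omega> > 0"
  unfolding alpha_bar_def
  using summable_inverse_conv_den conv_den_ge_1
  by (intro suminf_pos) (auto intro: less_le_trans[OF zero_less_one])

text \<open>Inserting the exact remainder \<open>?x\<close> into the Moebius form and using the
  determinant gives the identity \<open>?D * \<bar>p - q * \<omega>\<bar> = ?x\<close>. The upper
  bound then amounts to \<open>?D\<close> being at least \<open>?x\<close> times the next
  denominator.\<close>

lemma convergent_distance:
  "0 < \<bar>of_int (conv_num \<omega> n) - of_int (conv_den \<omega> n) * \<omega>\<bar>"
  "\<bar>of_int (conv_num \<omega> n) - of_int (conv_den \<omega> n) * \<omega>\<bar> * of_int (conv_den \<omega> (Suc n)) \<le> 1"
proof -
  let ?h = "\<lambda>n. real_of_int (cf_seq (cf_quot \<omega>) 1 0 n)" and ?k = "\<lambda>n. real_of_int (cf_seq (cf_quot \<omega>) 0 1 n)"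
  let ?x = "cf_rem \<omega> n"
  let ?D = "?k (Suc n) + ?x * ?k n"
  have x: "?x > 0" using cf_rem_bounds by blast
  have k: "?k n \<ge> 0" "?k (Suc n) \<ge> 1"
    using cf_seq_den_pos[of "cf_quot \<omega>" n] cf_quot_pos by auto
  then have D: "?D > 0"
    using x by (intro add_pos_nonneg mult_nonneg_nonneg) auto
  have "\<omega> = (?h (Suc n) + ?x * ?h n) / ?D"
    using cf_tail_eq[of "cf_quot \<omega>" ?x n] cf_quot_pos x cf_tail_cf_rem[of n] by auto
  then have "?D * \<omega> = ?h (Suc n) + ?x * ?h n"
    using D by (simp add: field_simps)
  then have "?D * (?h (Suc n) - ?k (Suc n) * \<omega>) = ?x * (?h (Suc n) * ?k n - ?h n * ?k (Suc n))"
    by (simp add: right_diff_distrib mult.left_commute[of ?D]) (simp add: algebra_simps)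
  also have "\<dots> = ?x * (- 1) ^ Suc n"
    using arg_cong[OF cf_seq_det[of "cf_quot \<omega>" n], of real_of_int] by simp
  finally have "\<bar>?D * (?h (Suc n) - ?k (Suc n) * \<omega>)\<bar> = ?x"
    using x by (simp add: abs_mult power_abs)
  then have dist: "?D * \<bar>?h (Suc n) - ?k (Suc n) * \<omega>\<bar> = ?x"
    using D by (simp add: abs_mult)
  then show "0 < \<bar>of_int (conv_num \<omega> n) - of_int (conv_den \<omega> n) * \<omega>\<bar>"
    using x by (auto simp: conv_eq)
  have "?x * ?k (Suc (Suc n)) = ?x * (of_int (cf_quot \<omega> (Suc n)) * ?k (Suc n)) + ?x * ?k n"
    by (simp add: algebra_simps)
  also have "?x * (of_int (cf_quot \<omega> (Suc n)) * ?k (Suc n)) \<le> 1 * ?k (Suc n)"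
  proof -
    \<comment> \<open>The quotient is the integer part of the reciprocal of the remainder.\<close>
    have "of_int (cf_quot \<omega> (Suc n)) \<le> 1 / ?x"
      by (simp add: cf_quot_def)
    then have "?x * of_int (cf_quot \<omega> (Suc n)) \<le> 1"
      using x by (simp add: field_simps)
    then show ?thesis
      using k by (metis mult.assoc mult_right_mono order_trans zero_le_one)
  qed
  finally have "?x * ?k (Suc (Suc n)) \<le> ?D" by simp
  then have "?D * (\<bar>?h (Suc n) - ?k (Suc n) * \<omega>\<bar> * ?k (Suc (Suc n))) \<le> ?D * 1"
    using dist by (simp only: mult.assoc[symmetric] mult_1_right)
  then have "\<bar>?h (Suc n) - ?k (Suc n) * \<omega>\<bar> * ?k (Suc (Suc n)) \<le> 1"
    using D by (simp only: mult_le_cancel_left_pos)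
  then show "\<bar>of_int (conv_num \<omega> n) - of_int (conv_den \<omega> n) * \<omega>\<bar> * of_int (conv_den \<omega> (Suc n)) \<le> 1"
    by (simp only: conv_eq)
qed

end

subsection \<open>Brjuno-type sums\<close>

lemma ennreal_suminf_neq_top_if_le:
  assumes "summable g" and "\<And>n. 0 \<le> f n" and "\<And>n. f n \<le> g n"
  shows "(\<Sum>n. ennreal (f n)) \<noteq> \<infinity>"
proof -
  have "summable f"
    by (rule summable_comparison_test'[OF assms(1)]) (use assms in auto)
  then show ?thesis
    using assms(2) by (simp add: suminf_ennreal2)
qed

text \<open>Raise \<open>1 + y \<le> exp y\<close> with \<open>y = c * x / Suc m\<close> to the
  power \<open>Suc m\<close>; the exponential then becomes \<open>exp (c * x)\<close>.\<close>

lemma power_mult_exp_neg_bounded: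
  fixes c :: real
  assumes "c > 0"
  obtains K where "\<And>x. 0 \<le> x \<Longrightarrow> x ^ Suc m * exp (- (c * x)) \<le> K"
proof
  fix x :: real
  assume "0 \<le> x"
  let ?m = "real (Suc m)"
  have "0 \<le> c * x / ?m"
    using assms \<open>0 \<le> x\<close> by simp
  then have "(c * x / ?m) ^ Suc m \<le> exp (c * x / ?m) ^ Suc m"
    using exp_ge_add_one_self[of "c * x / ?m"] by (intro power_mono) linarith+
  also have "\<dots> = exp (c * x)"
    unfolding exp_of_nat_mult[symmetric] by simp
  finally have "(c / ?m) ^ Suc m * (x ^ Suc m) \<le> exp (c * x)"
    by (simp only: power_mult_distrib[symmetric] times_divide_eq_left)
  then have "(c / ?m) ^ Suc m * (x ^ Suc m * exp (- (c * x))) \<le> exp (c * x) * exp (- (c * x))"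
    unfolding mult.assoc[symmetric] by (intro mult_right_mono) auto
  also have "\<dots> = 1"
    by (simp flip: exp_add)
  finally show "x ^ Suc m * exp (- (c * x)) \<le> 1 / (c / ?m) ^ Suc m"
    using assms by (simp add: pos_le_divide_eq mult.commute)
qed

text \<open>The gap \<open>D - D'\<close> leaves a decaying exponential that beats any power of the
  denominator, so every term is at most a constant over \<open>q n\<close>. In the second sum the
  logarithm costs another factor \<open>q (Suc n)\<close>; the doubled \<open>D\<close> pays for it,
  making the term at most a square of the first kind.\<close>

lemma Brj_finite:
  fixes \<omega> D D' C :: real
  assumes \<omega>: "0 < \<omega>" "\<omega> < 1" "\<omega> \<notin> \<rat>" and "D' < D"
    and growth: "\<And>n. n \<ge> 1 \<Longrightarrow>
      real_of_int (conv_den \<omega> (Suc n)) \<le> C * of_int (conv_den \<omega> n) * exp (D' * of_int (conv_den \<omega> n))"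
  shows "Brj1 \<omega> D \<noteq> \<infinity>" and "Brj2 \<omega> (2 * D) \<noteq> \<infinity>"
proof -
  define q where "q = (\<lambda>n. real_of_int (conv_den \<omega> (Suc n)))"
  define c where "c = D - D'"
  have c: "c > 0"
    using assms by (simp add: c_def)
  have q: "q n \<ge> 1" for n
    using conv_den_ge_1[OF \<omega>] by (simp add: q_def)
  have q0: "q n > 0" for n
    using q[of n] by linarith
  have qC: "q (Suc n) \<le> C * q n * exp (D' * q n)" for n
    using growth[of "Suc n"] by (simp add: q_def)
  \<comment> \<open>The sign of \<open>C\<close> is forced by the growth bound, whose left side is
    positive.\<close>
  have "0 < C * q 0 * exp (D' * q 0)"
    using q0[of 1] qC[of 0] by simp
  then have C: "C > 0"
    using q0[of 0] by (simp add: zero_less_mult_iff)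
  have summable: "summable (\<lambda>n. B * (1 / q n))" for B
    unfolding q_def by (intro summable_mult summable_inverse_conv_den[OF \<omega>])
  have decay: "exp (- (q n * D)) * q (Suc n) \<le> C * (q n * exp (- (c * q n)))" for n
  proof -
    have "exp (- (q n * D)) * q (Suc n) \<le> exp (- (q n * D)) * (C * q n * exp (D' * q n))"
      by (intro mult_left_mono qC) auto
    also have "\<dots> = C * q n * (exp (- (q n * D)) * exp (D' * q n))"
      by simp
    also have "exp (- (q n * D)) * exp (D' * q n) = exp (- (c * q n))"
      unfolding exp_add[symmetric] by (simp add: c_def algebra_simps)
    finally show ?thesis by simp
  qed
  show "Brj1 \<omega> D \<noteq> \<infinity>"
  proof -
    \<comment> \<open>Power 2: one factor \<open>q n\<close> is present already, and one more
      produces \<open>1 / q n\<close>.\<close>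
    obtain K where K: "\<And>x. 0 \<le> x \<Longrightarrow> x ^ Suc 1 * exp (- (c * x)) \<le> K"
      using power_mult_exp_neg_bounded[OF c] by blast
    have "exp (- (q n * D)) * q (Suc n) \<le> C * K * (1 / q n)" for n
    proof -
      have "q n * exp (- (c * q n)) \<le> K * (1 / q n)"
        using K[of "q n"] q0[of n] by (simp add: field_simps)
      then have "C * (q n * exp (- (c * q n))) \<le> C * (K * (1 / q n))"
        using C by (intro mult_left_mono) auto
      with decay[of n] show ?thesis by simp
    qed
    then have "(\<Sum>n. ennreal (exp (- (q n * D)) * q (Suc n))) \<noteq> \<infinity>"
      using q0 by (intro ennreal_suminf_neq_top_if_le[OF summable]) (auto intro: less_imp_le)
    then show ?thesis by (simp add: Brj1_def q_def)
  qed
  show "Brj2 \<omega> (2 * D) \<noteq> \<infinity>"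
  proof -
    let ?a = "\<lambda>n. real_of_int (cf_quot \<omega> (Suc (Suc n)))"
    have a: "?a n \<ge> 1" for n
      using cf_quot_pos[OF \<omega>, of "Suc (Suc n)"] by simp
    have aq: "?a n \<le> q (Suc n)" for n
      using cf_quot_le_conv_den[OF \<omega>, of "Suc n"] by (simp add: q_def)
    have "2 * c > 0"
      using c by simp
    \<comment> \<open>Power 3 at rate \<open>2 * c\<close>: squaring gives two factors
      \<open>q n\<close>, and the third produces \<open>1 / q n\<close>.\<close>
    then obtain K where K: "\<And>x. 0 \<le> x \<Longrightarrow> x ^ Suc 2 * exp (- (2 * c * x)) \<le> K"
      using power_mult_exp_neg_bounded by blast
    have "exp (- (q n * (2 * D))) * q (Suc n) * ln (?a n) \<le> C\<^sup>2 * K * (1 / q n)" for n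
    proof -
      have "exp (- (q n * (2 * D))) = (exp (- (q n * D)))\<^sup>2"
        by (simp flip: exp_double)
      moreover have "ln (?a n) \<le> q (Suc n)"
        using ln_le_minus_one[of "?a n"] a[of n] aq[of n] by linarith
      ultimately have "exp (- (q n * (2 * D))) * q (Suc n) * ln (?a n) \<le> (exp (- (q n * D)))\<^sup>2 * q (Suc n) * q (Suc n)"
        using q0[of "Suc n"] by (simp add: mult_left_mono)
      also have "\<dots> = (exp (- (q n * D)) * q (Suc n))\<^sup>2"
        by (simp add: power2_eq_square)
      also have "\<dots> \<le> (C * (q n * exp (- (c * q n))))\<^sup>2"
        using q0[of "Suc n"] by (intro power_mono decay) simp
      also have "\<dots> = C\<^sup>2 * ((q n)\<^sup>2 * exp (- (2 * c * q n)))"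
      proof -
        have "(exp (- (c * q n)))\<^sup>2 = exp (- (2 * c * q n))"
          by (simp flip: exp_double)
        then show ?thesis by (simp add: power_mult_distrib)
      qed
      also have "(q n)\<^sup>2 * exp (- (2 * c * q n)) \<le> K * (1 / q n)"
        using K[of "q n"] q0[of n] by (simp add: field_simps power2_eq_square power3_eq_cube)
      finally show ?thesis
        using C by (simp add: mult_left_mono)
    qed
    then have "(\<Sum>n. ennreal (exp (- (q n * (2 * D))) * q (Suc n) * ln (?a n))) \<noteq> \<infinity>"
      using q0 a by (intro ennreal_suminf_neq_top_if_le[OF summable]) (auto intro!: mult_nonneg_nonneg less_imp_le[OF q0])
    then show ?thesis by (simp add: Brj2_def q_def)
  qed
qed

section \<open>Coefficient decay against small divisors at the convergents\<close>

theorem lemma6p2: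
  fixes \<rho> \<epsilon> \<omega> \<delta> \<delta>' \<Delta> :: real
    and a :: "complex \<times> complex \<Rightarrow> complex"
  assumes "\<rho> > 0" and "\<epsilon> > 0"
    and "0 < \<omega>" and "\<omega> < 1" and "\<omega> \<notin> \<rat>"
    and "0 < \<delta>'" and "\<delta>' < \<delta>" and "\<delta> < \<rho>"
    and "\<Delta> = (1 + \<omega>) * \<delta>"
    and "Brj1 \<omega> \<Delta> = \<infinity> \<or> Brj2 \<omega> (2 * \<Delta>) = \<infinity>"
    and "torus_avg a = 0"
    and "\<And>n p q. n \<ge> 1 \<Longrightarrow>
           (p, q) = (conv_num \<omega> n, conv_den \<omega> n) \<or> (p, q) = - (conv_num \<omega> n, conv_den \<omega> n) \<Longrightarrow>
           fourier_coeff a p q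
             = complex_of_real (\<epsilon> * exp (- \<rho> * (\<bar>of_int p\<bar> + \<bar>of_int q\<bar>)) * alpha \<omega> n)"
    and "\<And>p q. (p, q) \<noteq> (0, 0) \<Longrightarrow>
           \<not> (\<exists>n\<ge>1. (p, q) = (conv_num \<omega> n, conv_den \<omega> n)
                  \<or> (p, q) = - (conv_num \<omega> n, conv_den \<omega> n)) \<Longrightarrow>
           fourier_coeff a p q = 0"
  shows "\<not> series_in_P0 (formal_solution \<omega> a) (\<rho> - \<delta>')"
proof
  note \<omega> = \<open>0 < \<omega>\<close> \<open>\<omega> < 1\<close> \<open>\<omega> \<notin> \<rat>\<close>
  assume "series_in_P0 (formal_solution \<omega> a) (\<rho> - \<delta>')"
  then obtain b where b: "b \<in> P0 (\<rho> - \<delta>')" and coeff: "\<And>p q. fourier_coeff b p q = formal_solution \<omega> a p q"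
    unfolding series_in_P0_def by blast
  \<comment> \<open>The midpoint makes both inequalities strict: one keeps the shifted contours
    inside the open strip, the other leaves a gap below \<open>\<Delta>\<close>.\<close>
  define \<sigma> where "\<sigma> = (\<delta> + \<delta>') / 2"
  have \<sigma>: "\<delta>' < \<sigma>" "\<sigma> < \<delta>" "0 < \<sigma>"
    using assms by (auto simp: \<sigma>_def)
  then have "0 < \<rho> - \<sigma>" "\<rho> - \<sigma> < \<rho> - \<delta>'"
    using assms by auto
  from fourier_coeff_exp_decay[OF b this] obtain M where
    M: "\<And>p q. norm (formal_solution \<omega> a p q) \<le> M * exp (- (\<rho> - \<sigma>) * (\<bar>of_int p\<bar> + \<bar>of_int q\<bar>))"
    unfolding coeff by blast
  have ab: "alpha_bar \<omega> > 0"
    by (rule alpha_bar_pos[OF \<omega>])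
  \<comment> \<open>The constant gathers the decay bound, the normalisation in \<open>alpha\<close>,
    and \<open>exp \<sigma>\<close> from the 1 in \<open>p \<le> 1 + q * \<omega>\<close>. The
    absolute value is taken because the sign of \<open>M\<close> is not known.\<close>
  define C where "C = \<bar>M\<bar> * (2 * alpha_bar \<omega>) / \<epsilon> * exp \<sigma>"
  have growth: "real_of_int (conv_den \<omega> (Suc n))
      \<le> C * of_int (conv_den \<omega> n) * exp ((1 + \<omega>) * \<sigma> * of_int (conv_den \<omega> n))" if "n \<ge> 1" for n
  proof -
    define p q q' where "p = real_of_int (conv_num \<omega> n)" and "q = real_of_int (conv_den \<omega> n)"
      and "q' = real_of_int (conv_den \<omega> (Suc n))"
    define d where "d = \<bar>p - q * \<omega>\<bar>"
    have p: "p \<ge> 0" and q: "q \<ge> 1" and q': "q' \<ge> 1"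
      using conv_num_nonneg[OF \<omega>, of n] conv_den_ge_1[OF \<omega>] by (auto simp: p_def q_def q'_def)
    have d: "0 < d" "d * q' \<le> 1"
      using convergent_distance[OF \<omega>, of n] by (auto simp: d_def p_def q_def q'_def)
    \<comment> \<open>Since \<open>q' \<ge> 1\<close>, the distance is at most 1, which replaces
      \<open>p\<close> by a multiple of \<open>q\<close> in the exponent.\<close>
    have "d * 1 \<le> d * q'"
      using d q' by (intro mult_left_mono) auto
    with d(2) have "d \<le> 1"
      by linarith
    then have "p \<le> 1 + q * \<omega>"
      unfolding d_def by linarith
    then have expo: "\<sigma> * (p + q) \<le> \<sigma> * (1 + q * \<omega> + q)"
      using \<sigma> by (intro mult_left_mono) auto
    have alpha: "alpha \<omega> n > 0"
      using ab q by (simp add: alpha_def q_def)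
    have "fourier_coeff a (conv_num \<omega> n) (conv_den \<omega> n) = complex_of_real (\<epsilon> * exp (- \<rho> * (p + q)) * alpha \<omega> n)"
      using assms(12)[OF that, of "conv_num \<omega> n" "conv_den \<omega> n"] p q by (simp add: p_def q_def)
    moreover have "conv_den \<omega> n \<noteq> 0"
      using q by (auto simp: q_def)
    ultimately have "formal_solution \<omega> a (conv_num \<omega> n) (conv_den \<omega> n)
        = complex_of_real (\<epsilon> * exp (- \<rho> * (p + q)) * alpha \<omega> n) / (\<i> * complex_of_real (p - q * \<omega>))"
      by (simp add: formal_solution_def p_def q_def)
    then have "norm (formal_solution \<omega> a (conv_num \<omega> n) (conv_den \<omega> n))
        = \<epsilon> * exp (- \<rho> * (p + q)) * alpha \<omega> n / d"
      using \<open>\<epsilon> > 0\<close> alpha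
      by (simp only: norm_divide norm_mult norm_ii norm_of_real mult_1_left d_def abs_mult abs_exp_cancel abs_of_pos)
    then have "\<epsilon> * exp (- \<rho> * (p + q)) * alpha \<omega> n / d \<le> M * exp (- (\<rho> - \<sigma>) * (p + q))"
      using M[of "conv_num \<omega> n" "conv_den \<omega> n"] p q by (simp add: p_def q_def)
    also have "\<dots> \<le> \<bar>M\<bar> * exp (- (\<rho> - \<sigma>) * (p + q))"
      by (intro mult_right_mono) auto
    also have "- (\<rho> - \<sigma>) * (p + q) = - \<rho> * (p + q) + \<sigma> * (p + q)"
      by (simp add: algebra_simps)
    also have "\<bar>M\<bar> * exp \<dots> = exp (- \<rho> * (p + q)) * (\<bar>M\<bar> * exp (\<sigma> * (p + q)))"
      by (simp only: exp_add mult.left_commute)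
    \<comment> \<open>The decay prescribed for the data occurs on both sides and cancels; what
      remains is the loss \<open>exp (\<sigma> * (p + q))\<close>.\<close>
    finally have "exp (- \<rho> * (p + q)) * (\<epsilon> * alpha \<omega> n / d)
        \<le> exp (- \<rho> * (p + q)) * (\<bar>M\<bar> * exp (\<sigma> * (p + q)))"
      by (simp only: mult_ac times_divide_eq_right times_divide_eq_left)
    then have "\<epsilon> * alpha \<omega> n / d \<le> \<bar>M\<bar> * exp (\<sigma> * (p + q))"
      by (simp only: mult_le_cancel_left_pos exp_gt_zero)
    moreover have "1 / d \<ge> q'"
      using d by (simp add: field_simps)
    then have "\<epsilon> * alpha \<omega> n * q' \<le> \<epsilon> * alpha \<omega> n * (1 / d)"
      using \<open>\<epsilon> > 0\<close> alpha by (intro mult_left_mono) auto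
    moreover have "\<bar>M\<bar> * exp (\<sigma> * (p + q)) \<le> \<bar>M\<bar> * exp (\<sigma> * (1 + q * \<omega> + q))"
      using expo by (intro mult_left_mono) auto
    ultimately have "\<epsilon> * alpha \<omega> n * q' \<le> \<bar>M\<bar> * exp (\<sigma> * (1 + q * \<omega> + q))"
      by simp
    also have "exp (\<sigma> * (1 + q * \<omega> + q)) = exp \<sigma> * exp ((1 + \<omega>) * \<sigma> * q)"
      by (simp add: algebra_simps flip: exp_add)
    also have "alpha \<omega> n = 1 / (2 * alpha_bar \<omega> * q)"
      by (simp add: alpha_def q_def)
    finally have "\<epsilon> * q' / (2 * alpha_bar \<omega> * q) \<le> \<bar>M\<bar> * (exp \<sigma> * exp ((1 + \<omega>) * \<sigma> * q))"
      by simp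
    then have "\<epsilon> * q' \<le> \<bar>M\<bar> * (exp \<sigma> * exp ((1 + \<omega>) * \<sigma> * q)) * (2 * alpha_bar \<omega> * q)"
      using ab q by (subst (asm) pos_divide_le_eq) auto
    then have "q' \<le> C * q * exp ((1 + \<omega>) * \<sigma> * q)"
      using \<open>\<epsilon> > 0\<close> by (simp add: C_def field_simps)
    then show ?thesis
      by (simp only: q_def q'_def)
  qed
  \<comment> \<open>This is the exponential gap that makes both sums finite, against the assumed
    divergence of one of them.\<close>
  have "(1 + \<omega>) * \<sigma> < \<Delta>"
    using \<sigma> assms by simp
  from Brj_finite[OF \<omega> this growth] show False
    using assms(10) by blast
qed

end
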